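(* Let $\beta=(\beta_x,\beta_y)\in(0,+\infty)^2$, $\beta_{\max}=\max(\beta_x,\beta_y)$, $z=(x,y)\in\mathcal Z$ and $f\in\Gamma_0(\mathcal X)$. Assume: (i) the Fenchel conjugate $f^*$ is separable: with respect to an orthogonal decomposition $\mathcal X=\mathcal X_1\times\mathcal X_2$, $f^*(\mu)=f_1^*(\mu_1)+f_2^*(\mu_2)$ for all $\mu=(\mu_1,\mu_2)\in\mathcal X$; (ii) $f_1^*$ is $L_{f_1^*}$-Lipschitz on its domain $\mathrm{dom}f_1^*$; (iii) $\mathrm{dom}f_2^*$ is a non-empty affine space; (iv) for some $\mu_0\in\mathrm{dom}f_2^*$, the function $g(\lambda)=f_2^*(\mu_0+\phi^{-1}(\lambda))$, where $\phi$ is the orthonormal coordinate map of the vector space $\mathrm{dom}f_2^*-\mu_0$, is differentiable and has an $L_g$-Lipschitz gradient. Then $$\mathcal D(z)\ \le\ \Big((3+\beta_xL_g)\,\mathcal G_\beta(z)+\big(\sqrt{2\beta_x}\,(2\|x\|+L_{f_1^*})+\sqrt{2\beta_y}\,\|y\|\big)\sqrt{\mathcal G_\beta(z)}\Big)^2+2\beta_{\max}\,\mathcal G_\beta(z).$$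
   Context: $\mathcal X,\mathcal Y$ are finite-dimensional Euclidean spaces, $\mathcal Z=\mathcal X\times\mathcal Y$. $\Gamma_0(\mathcal X)$ is the set of proper, lower semicontinuous, convex functions $\mathcal X\to\mathbb R\cup\{+\infty\}$. $A:\mathcal X\to\mathcal Y$ is linear with adjoint $A^T$, and $b\in\mathcal Y$. $f^*(\mu)=\sup_x\langle\mu,x\rangle-f(x)$ is the Fenchel conjugate. Coordinate map: for the vector space $V=\mathrm{dom}f_2^*-\mu_0$ of dimension $k$, fix an orthonormal basis $v_1,\dots,v_k$ and let $\phi:V\to\mathbb R^k$, $\phi(\sum_i\lambda_iv_i)=\lambda$; so $\phi^{-1}(\lambda)=\sum_i\lambda_iv_i$ and $g$ is defined on $\mathbb R^k$. The self-centered smoothed duality gap is $$\mathcal G_\beta(z)=f(x)-f(p)+\langle A(x-p),y\rangle-\tfrac{\beta_x}{2}\|p-x\|^2+\tfrac1{2\beta_y}\|Ax-b\|^2,\qquad p=\mathrm{Prox}_{\beta_x^{-1}f}\big(x-\tfrac1{\beta_x}A^Ty\big),$$ where $\mathrm{Prox}_{sf}(x)=\arg\min_{x'}f(x')+\frac1{2s}\|x'-x\|^2$. The projected duality gap is $$\mathcal D(z)=|f(x)+f^*(a)+\langle b,y\rangle|^2+\|a+A^Ty\|^2+\|Ax-b\|^2,\qquad a=\mathrm{Proj}_{\mathrm{dom} f^*}(-A^Ty).$$ The saddle point problem $\min_x\max_y f(x)+\langle Ax-b,y\rangle$ is assumed throughout to have a solution. *)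

theory Defs
  imports "HOL-Analysis.Analysis"
begin

definition proper :: "('a \<Rightarrow> ereal) \<Rightarrow> bool" where
  "proper f \<longleftrightarrow> (\<forall>x. f x \<noteq> -\<infinity>) \<and> (\<exists>x. f x \<noteq> \<infinity>)"

definition lower_semicontinuous :: "('a::topological_space \<Rightarrow> ereal) \<Rightarrow> bool" where
  "lower_semicontinuous f \<longleftrightarrow> (\<forall>x. f x \<le> Liminf (at x) f)"

text \<open>This Jensen inequality is the usual notion of convexity for functions that avoid
  \<open>-\<infinity>\<close>, which is the only case it is used for; the end points
  are harmless because \<open>0 * \<infinity> = 0\<close> in \<open>ereal\<close>.\<close>

definition convex_ereal :: "('a::real_vector \<Rightarrow> ereal) \<Rightarrow> bool" where
  "convex_ereal f \<longleftrightarrow>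
     (\<forall>x y. \<forall>t\<in>{0..1}. f ((1 - t) *\<^sub>R x + t *\<^sub>R y) \<le> ereal (1 - t) * f x + ereal t * f y)"

definition Gamma0 :: "('a::euclidean_space \<Rightarrow> ereal) set" where
  "Gamma0 = {f. proper f \<and> lower_semicontinuous f \<and> convex_ereal f}"

text \<open>Functions on a subspace \<open>S\<close> are represented by functions on the whole type whose values
  outside \<open>S\<close> are irrelevant. Hence conjugates and effective domains are taken relative to
  \<open>S\<close>: the supremum runs over \<open>S\<close> only, and the domain contains only points of \<open>S\<close>.\<close>

definition fenchel_conjugate_on ::
    "'a::real_inner set \<Rightarrow> ('a \<Rightarrow> ereal) \<Rightarrow> 'a \<Rightarrow> ereal" where
  "fenchel_conjugate_on S f \<mu> = (SUP x\<in>S. ereal (\<mu> \<bullet> x) - f x)"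

abbreviation fenchel_conjugate :: "('a::real_inner \<Rightarrow> ereal) \<Rightarrow> 'a \<Rightarrow> ereal" where
  "fenchel_conjugate \<equiv> fenchel_conjugate_on UNIV"

definition dom_on :: "'a set \<Rightarrow> ('a \<Rightarrow> ereal) \<Rightarrow> 'a set" where
  "dom_on S f = {x \<in> S. f x < \<infinity>}"

definition prox :: "real \<Rightarrow> ('a::real_inner \<Rightarrow> ereal) \<Rightarrow> 'a \<Rightarrow> 'a" where
  "prox s f x = arg_min (\<lambda>x'. f x' + ereal (1 / (2 * s) * (norm (x' - x))\<^sup>2)) (\<lambda>_. True)"

definition orthogonal_decomposition :: "'a::real_inner set \<Rightarrow> 'a set \<Rightarrow> bool" where
  "orthogonal_decomposition X1 X2 \<longleftrightarrow>
     subspace X1 \<and> subspace X2 \<and> (\<forall>u\<in>X1. \<forall>w\<in>X2. orthogonal u w) \<and>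
     (\<forall>x. \<exists>u\<in>X1. \<exists>w\<in>X2. x = u + w)"

definition orthonormal_basis_on :: "'k set \<Rightarrow> ('k \<Rightarrow> 'a::real_inner) \<Rightarrow> 'a set \<Rightarrow> bool" where
  "orthonormal_basis_on K v V \<longleftrightarrow>
     (\<forall>i\<in>K. \<forall>j\<in>K. v i \<bullet> v j = (if i = j then 1 else 0)) \<and> span (v ` K) = V"

text \<open>The space of coordinate vectors with index set \<open>K\<close>, a copy of Euclidean \<open>k\<close>-space for
  \<open>k = card K\<close>. Since a type \<open>real^'k\<close> is never zero-dimensional, a subset \<open>K\<close> of the index type
  is used so that \<open>k = 0\<close> is covered as well.\<close>

definition coord_space :: "'k::finite set \<Rightarrow> (real^'k) set" where
  "coord_space K = {l. \<forall>i. i \<notin> K \<longrightarrow> l $ i = 0}"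

text \<open>The inverse of the coordinate map of the orthonormal family \<open>v\<close>.\<close>

definition coord_inv :: "'k::finite set \<Rightarrow> ('k \<Rightarrow> 'a::real_vector) \<Rightarrow> real^'k \<Rightarrow> 'a" where
  "coord_inv K v l = (\<Sum>i\<in>K. (l $ i) *\<^sub>R v i)"

text \<open>Meant for a linear subspace \<open>E\<close>, regarded as a Euclidean space in its own right:
  the gradient at each point is required to lie in \<open>E\<close>, and is then unique.\<close>

definition has_lipschitz_gradient_on ::
    "real \<Rightarrow> 'c::real_inner set \<Rightarrow> ('c \<Rightarrow> real) \<Rightarrow> bool" where
  "has_lipschitz_gradient_on L E g \<longleftrightarrow>
     (\<exists>G. (\<forall>l\<in>E. G l \<in> E \<and> (g has_derivative (\<lambda>h. G l \<bullet> h)) (at l within E)) \<and>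
          L-lipschitz_on E G)"

definition saddle_point ::
    "('a::real_inner \<Rightarrow> ereal) \<Rightarrow> ('a \<Rightarrow> 'b::real_inner) \<Rightarrow> 'b \<Rightarrow> 'a \<Rightarrow> 'b \<Rightarrow> bool" where
  "saddle_point f A b x y \<longleftrightarrow>
     (\<forall>y'. f x + ereal ((A x - b) \<bullet> y') \<le> f x + ereal ((A x - b) \<bullet> y)) \<and>
     (\<forall>x'. f x + ereal ((A x - b) \<bullet> y) \<le> f x' + ereal ((A x' - b) \<bullet> y))"

text \<open>Both gaps are extended real: they are \<open>\<infinity>\<close> when \<open>f x = \<infinity>\<close>.\<close>

definition smoothed_gap ::
    "('a::euclidean_space \<Rightarrow> ereal) \<Rightarrow> ('a \<Rightarrow> 'b::euclidean_space) \<Rightarrow> 'b \<Rightarrow>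
     real \<Rightarrow> real \<Rightarrow> 'a \<Rightarrow> 'b \<Rightarrow> ereal" where
  "smoothed_gap f A b \<beta>x \<beta>y x y =
     (let p = prox (inverse \<beta>x) f (x - (1 / \<beta>x) *\<^sub>R adjoint A y)
      in f x - f p + ereal (A (x - p) \<bullet> y - \<beta>x / 2 * (norm (p - x))\<^sup>2
                            + 1 / (2 * \<beta>y) * (norm (A x - b))\<^sup>2))"

definition projected_gap ::
    "('a::euclidean_space \<Rightarrow> ereal) \<Rightarrow> ('a \<Rightarrow> 'b::euclidean_space) \<Rightarrow> 'b \<Rightarrow>
     'a \<Rightarrow> 'b \<Rightarrow> ereal" where
  "projected_gap f A b x y =
     (let a = closest_point (dom_on UNIV (fenchel_conjugate f)) (- adjoint A y)
      in \<bar>f x + fenchel_conjugate f a + ereal (b \<bullet> y)\<bar>\<^sup>2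
         + ereal ((norm (a + adjoint A y))\<^sup>2) + ereal ((norm (A x - b))\<^sup>2))"

definition ereal_sqrt :: "ereal \<Rightarrow> ereal" where
  "ereal_sqrt r = (if r = \<infinity> then \<infinity> else ereal (sqrt (real_of_ereal r)))"

end

theory Submission
  imports Defs
begin

text \<open>Let \<open>q = \<beta>x (x - p) - A\<^sup>T y\<close>, which is a subgradient of \<open>f\<close> at \<open>p\<close>, and put
  \<open>s = q + A\<^sup>T y\<close>. Equality in Fenchel's inequality at \<open>(p, q)\<close> turns the smoothed gap into the
  sum of three nonnegative terms
  \<open>e + \<parallel>s\<parallel>\<^sup>2 / (2 \<beta>x) + \<parallel>A x - b\<parallel>\<^sup>2 / (2 \<beta>y)\<close> with \<open>e = f x + f\<^sup>* q - \<langle>x, q\<rangle>\<close>.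
  The domain of \<open>f\<^sup>*\<close> is closed, convex and contains \<open>q\<close>, so projecting onto it gives
  \<open>\<parallel>a - q\<parallel> \<le> \<parallel>s\<parallel>\<close>. In passing from \<open>f\<^sup>* q\<close> to \<open>f\<^sup>* a\<close>, the first component costs at most
  \<open>L1 \<parallel>s\<parallel>\<close>; along the second one, the Fenchel-Young gap is a nonnegative function with
  Lipschitz gradient, so its value at \<open>a\<close> is controlled by its value \<open>e\<close> at \<open>q\<close> and
  by \<open>\<parallel>s\<parallel>\<^sup>2\<close>.\<close>

section \<open>Proximal points\<close>

text \<open>The complement is open: a real \<open>c\<close> strictly between \<open>r - h z\<close>
  and \<open>f z\<close> stays between \<open>r - h\<close> and \<open>f\<close> on a whole
  neighbourhood of \<open>z\<close>. The continuous summand \<open>h\<close> is there to take the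
  quadratic term of the proximal objective.\<close>

lemma lower_semicontinuous_closed_sublevel:
  assumes "lower_semicontinuous f" and "continuous_on UNIV h"
  shows "closed {z. f z + ereal (h z) \<le> ereal r}"
proof -
  have lsc: "f z \<le> Liminf (at z) f" for z
    using assms(1) by (simp add: lower_semicontinuous_def)
  have "open {z. ereal (r - h z) < f z}"
  proof (rule topological_space_class.openI)
    fix z assume "z \<in> {z. ereal (r - h z) < f z}"
    then obtain c where c: "ereal (r - h z) < ereal c" "ereal c < f z"
      using ereal_dense2[of "ereal (r - h z)" "f z"] by auto
    have "eventually (\<lambda>w. ereal c < f w) (at z)"
      using c(2) lsc[of z] less_LiminfD by (metis order_less_le_trans)
    \<comment> \<open>The \<open>Liminf\<close> ranges over the punctured filter
      \<open>at z\<close>; the point \<open>z\<close> itself is covered by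
      \<open>ereal c < f z\<close>.\<close>
    then have "eventually (\<lambda>w. ereal c < f w) (nhds z)"
      unfolding eventually_at_filter by (rule eventually_mono) (use c(2) in auto)
    moreover have "open {w. r - h w < c}"
      by (intro open_Collect_less continuous_intros assms(2))
    then have "eventually (\<lambda>w. r - h w < c) (nhds z)"
      using c(1) by (auto simp: eventually_nhds)
    ultimately have "eventually (\<lambda>w. ereal (r - h w) < f w) (nhds z)"
      by eventually_elim (metis less_ereal.simps(1) order.strict_trans)
    then show "\<exists>T. open T \<and> z \<in> T \<and> T \<subseteq> {z. ereal (r - h z) < f z}"
      by (auto simp: eventually_nhds)
  qed
  moreover have "{z. f z + ereal (h z) \<le> ereal r} = - {z. ereal (r - h z) < f z}"
  proof -
    have "f z + ereal (h z) \<le> ereal r \<longleftrightarrow> \<not> ereal (r - h z) < f z" for z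
      by (cases "f z") auto
    then show ?thesis by auto
  qed
  ultimately show ?thesis by (simp add: closed_def)
qed

text \<open>The quadratic outgrows the affine minorant, so the sublevel sets of the objective are
  compact. The nonempty ones form a chain, and a point common to all of them is a minimiser.\<close>

lemma prox_objective_attains_min:
  fixes f :: "'a::euclidean_space \<Rightarrow> ereal"
  assumes f: "lower_semicontinuous f" and minorant: "\<And>z. ereal (w \<bullet> z - c) \<le> f z" and k: "k > 0"
  shows "\<exists>p. \<forall>z. f p + ereal (k * (norm (p - u))\<^sup>2) \<le> f z + ereal (k * (norm (z - u))\<^sup>2)"
proof -
  define F where "F z = f z + ereal (k * (norm (z - u))\<^sup>2)" for z
  define S where "S r = {z. F z \<le> ereal r}" for r
  define \<F> where "\<F> = {S r | r. S r \<noteq> {}}"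
  have bdd: "bounded (S r)" for r
  proof -
    define C where "C = \<bar>r + c - w \<bullet> u\<bar>"
    \<comment> \<open>Membership in \<open>S r\<close> gives
      \<open>k * t^2 \<le> norm w * t + C\<close> for the distance \<open>t\<close>. The summand 1
      in the radius ensures \<open>t > 1\<close>, which turns \<open>C\<close> into at most
      \<open>C * t\<close>, so that comparing with \<open>k * t\<close> suffices.\<close>
    have "norm (z - u) \<le> 1 + (norm w + C) / k" if "z \<in> S r" for z
    proof (rule ccontr)
      define t where "t = norm (z - u)"
      assume "\<not> norm (z - u) \<le> 1 + (norm w + C) / k"
      then have t: "t > 1 + (norm w + C) / k" by (simp add: t_def)
      have "0 \<le> (norm w + C) / k" using k by (simp add: C_def)
      then have t1: "t > 1" and t2: "t > (norm w + C) / k" using t by linarith+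
      have "ereal (w \<bullet> z - c) + ereal (k * (norm (z - u))\<^sup>2) \<le> F z"
        unfolding F_def by (intro add_mono minorant order_refl)
      also have "F z \<le> ereal r" using that by (simp add: S_def)
      finally have "w \<bullet> z - c + k * t\<^sup>2 \<le> r" by (simp add: t_def)
      moreover have "w \<bullet> z = w \<bullet> u + w \<bullet> (z - u)" by (simp add: inner_diff_right)
      moreover have "- (norm w * t) \<le> w \<bullet> (z - u)"
        using Cauchy_Schwarz_ineq2[of w "z - u"] by (simp add: t_def abs_le_iff)
      ultimately have "k * t\<^sup>2 \<le> norm w * t + C" by (simp add: C_def)
      also have "\<dots> \<le> (norm w + C) * t"
        using t1 mult_right_mono[of 1 t C] by (simp add: C_def algebra_simps)
      also have "\<dots> < (k * t) * t"
        using t2 t1 k by (intro mult_strict_right_mono) (auto simp: field_simps)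
      finally show False by (simp add: power2_eq_square mult.assoc)
    qed
    then have "S r \<subseteq> cball u (1 + (norm w + C) / k)"
      by (auto simp: dist_norm norm_minus_commute)
    then show ?thesis using bounded_cball bounded_subset by blast
  qed
  have "closed (S r)" for r
    unfolding S_def F_def by (intro lower_semicontinuous_closed_sublevel f continuous_intros)
  then have "compact (S r)" for r using bdd by (simp add: compact_eq_bounded_closed)
  moreover have "S r \<subseteq> S r'" if "r \<le> r'" for r r'
    using that by (auto simp: S_def intro: order_trans)
  then have "S r \<subseteq> S r' \<or> S r' \<subseteq> S r" for r r' by (meson linear)
  \<comment> \<open>If the objective is infinite everywhere, the family is empty, its intersection
    is \<open>UNIV\<close>, and any point minimises.\<close>
  ultimately have "\<Inter>\<F> \<noteq> {}"
    unfolding \<F>_def by (intro compact_chain) blast+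
  then obtain p where p: "p \<in> S r" if "S r \<noteq> {}" for r
    unfolding \<F>_def by blast
  have "F p \<le> F z" for z
  proof (cases "F z")
    case (real r)
    then have "z \<in> S r" by (simp add: S_def)
    then have "p \<in> S r" by (intro p) blast
    then show ?thesis using real by (simp add: S_def)
  next
    case MInf
    have "f z \<noteq> -\<infinity>" using minorant[of z] by auto
    then show ?thesis using MInf by (cases "f z") (auto simp: F_def)
  qed simp
  then show ?thesis unfolding F_def by blast
qed

text \<open>\<open>prox\<close> is an \<open>arg_min\<close>, hence an arbitrary choice until a
  minimiser is known to exist; the previous lemma supplies one.\<close>

lemma prox_minimal:
  fixes f :: "'a::euclidean_space \<Rightarrow> ereal"
  assumes "lower_semicontinuous f" and "\<And>z. ereal (w \<bullet> z - c) \<le> f z" and "s > 0"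
  shows "f (prox s f u) + ereal (1 / (2 * s) * (norm (prox s f u - u))\<^sup>2)
           \<le> f z + ereal (1 / (2 * s) * (norm (z - u))\<^sup>2)"
proof -
  define F where "F z = f z + ereal (1 / (2 * s) * (norm (z - u))\<^sup>2)" for z
  have "\<exists>p. \<forall>z. F p \<le> F z"
    unfolding F_def by (rule prox_objective_attains_min[OF assms(1,2)]) (use assms(3) in simp)
  then have "\<exists>p. is_arg_min F (\<lambda>_. True) p" by (simp add: is_arg_min_linorder)
  then have "is_arg_min F (\<lambda>_. True) (arg_min F (\<lambda>_. True))"
    unfolding arg_min_def by (rule someI_ex)
  then show ?thesis
    unfolding is_arg_min_linorder prox_def F_def by blast
qed

text \<open>Comparing \<open>p\<close> with the nearby point
  \<open>(1 - t) *\<^sub>R p + t *\<^sub>R z\<close> leaves, after convexity of \<open>f\<close> and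
  division by \<open>t\<close>, the claimed inequality up to an error \<open>t * c\<close> from the
  quadratic term. Letting \<open>t\<close> tend to 0 from the right removes it.\<close>

lemma prox_subgradient:
  fixes f :: "'a::euclidean_space \<Rightarrow> ereal" and u :: 'a
  assumes f: "f \<in> Gamma0" and minorant: "\<And>z. ereal (w \<bullet> z - c) \<le> f z" and s: "s > 0"
  defines "p \<equiv> prox s f u"
  shows "\<bar>f p\<bar> \<noteq> \<infinity>"
    and "f p + ereal (((1 / s) *\<^sub>R (u - p)) \<bullet> (z - p)) \<le> f z"
proof -
  have min: "f p + ereal (1 / (2 * s) * (norm (p - u))\<^sup>2)
           \<le> f z + ereal (1 / (2 * s) * (norm (z - u))\<^sup>2)" for z
    unfolding p_def using f by (intro prox_minimal[OF _ minorant s]) (simp add: Gamma0_def)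
  have notM: "f z \<noteq> -\<infinity>" for z using f by (simp add: Gamma0_def proper_def)
  obtain z0 where "f z0 \<noteq> \<infinity>" using f by (auto simp: Gamma0_def proper_def)
  then have "f p \<noteq> \<infinity>" using min[of z0] notM[of z0] by (cases "f z0") auto
  then show fin: "\<bar>f p\<bar> \<noteq> \<infinity>" using notM[of p] by auto
  show "f p + ereal (((1 / s) *\<^sub>R (u - p)) \<bullet> (z - p)) \<le> f z"
  proof (cases "f z")
    case (real fz)
    obtain fp where fp: "f p = ereal fp" using fin by auto
    define c where "c = (1 / (2 * s)) * (norm (z - p))\<^sup>2"
    have step: "fp + ((1 / s) *\<^sub>R (u - p)) \<bullet> (z - p) - fz \<le> t * c" if t: "0 < t" "t < 1" for t
    proof -
      let ?z = "(1 - t) *\<^sub>R p + t *\<^sub>R z"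
      have "f ?z \<le> ereal (1 - t) * f p + ereal t * f z"
        using f t by (auto simp: Gamma0_def convex_ereal_def)
      then have "f ?z \<le> ereal ((1 - t) * fp + t * fz)" using fp real by simp
      then have "f p + ereal (1 / (2 * s) * (norm (p - u))\<^sup>2)
          \<le> ereal ((1 - t) * fp + t * fz) + ereal (1 / (2 * s) * (norm (?z - u))\<^sup>2)"
        using min[of ?z] by (meson add_right_mono order_trans)
      then have 1: "fp + 1 / (2 * s) * (norm (p - u))\<^sup>2
          \<le> (1 - t) * fp + t * fz + 1 / (2 * s) * (norm (?z - u))\<^sup>2"
        using fp by simp
      have "?z - u = (p - u) + t *\<^sub>R (z - p)" by (simp add: algebra_simps)
      then have "(norm (?z - u))\<^sup>2
          = (norm (p - u))\<^sup>2 - 2 * t * ((u - p) \<bullet> (z - p)) + t\<^sup>2 * (norm (z - p))\<^sup>2"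
        unfolding power2_norm_eq_inner
        by (simp add: inner_add_left inner_add_right inner_diff_left inner_diff_right inner_commute
            power2_eq_square algebra_simps)
      then have "1 / (2 * s) * (norm (?z - u))\<^sup>2 = 1 / (2 * s) * (norm (p - u))\<^sup>2
          - t * (((1 / s) *\<^sub>R (u - p)) \<bullet> (z - p)) + t * (t * c)"
        unfolding inner_scaleR_left c_def using s by (simp only:) (simp add: field_simps power2_eq_square)
      with 1 have "t * (fp + ((1 / s) *\<^sub>R (u - p)) \<bullet> (z - p) - fz) \<le> t * (t * c)"
        by (simp add: algebra_simps)
      then show ?thesis using t by simp
    qed
    have "fp + ((1 / s) *\<^sub>R (u - p)) \<bullet> (z - p) - fz \<le> 0"
    proof (rule tendsto_lowerbound)
      show "((\<lambda>t. t * c) \<longlongrightarrow> 0) (at_right 0)" by (auto intro!: tendsto_eq_intros)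
      show "\<forall>\<^sub>F t in at_right 0. fp + ((1 / s) *\<^sub>R (u - p)) \<bullet> (z - p) - fz \<le> t * c"
        using eventually_at_right_real[of 0 1, OF zero_less_one]
        by (rule eventually_mono) (use step in auto)
    qed simp
    then show ?thesis using fp real by simp
  qed (use notM[of z] in auto)
qed

section \<open>Nonnegative functions with Lipschitz gradient\<close>

lemma quadratic_upper_bound:
  fixes \<phi> \<psi> :: "real \<Rightarrow> real"
  assumes deriv: "\<And>t. (\<phi> has_real_derivative \<psi> t) (at t)"
    and lip: "\<And>t. \<bar>\<psi> t - \<psi> 0\<bar> \<le> M * \<bar>t\<bar>"
  shows "\<phi> \<tau> \<le> \<phi> 0 + \<tau> * \<psi> 0 + M * \<tau>\<^sup>2 / 2"
proof -
  \<comment> \<open>The descent lemma by monotonicity of \<open>\<theta>\<close> on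
    \<open>[0, 1]\<close>. Scaling the argument as \<open>r * \<tau>\<close> treats both signs of
    \<open>\<tau>\<close> at once; the negative one is used below.\<close>
  define \<theta> where "\<theta> r = \<phi> (r * \<tau>) - r * \<tau> * \<psi> 0 - M * \<tau>\<^sup>2 * r\<^sup>2 / 2" for r
  have "\<theta> 1 \<le> \<theta> 0"
  proof (rule DERIV_nonpos_imp_nonincreasing[of 0 1 \<theta>])
    fix r :: real assume r: "0 \<le> r" "r \<le> 1"
    have "((\<lambda>r. \<phi> (r * \<tau>)) has_real_derivative \<psi> (r * \<tau>) * \<tau>) (at r)"
      by (rule DERIV_chain2[OF deriv]) (auto intro!: derivative_eq_intros)
    then have "(\<theta> has_real_derivative \<psi> (r * \<tau>) * \<tau> - \<tau> * \<psi> 0 - M * \<tau>\<^sup>2 * r) (at r)"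
      unfolding \<theta>_def by (auto intro!: derivative_eq_intros)
    moreover have "(\<psi> (r * \<tau>) - \<psi> 0) * \<tau> \<le> M * \<tau>\<^sup>2 * r"
    proof -
      have "(\<psi> (r * \<tau>) - \<psi> 0) * \<tau> \<le> \<bar>\<psi> (r * \<tau>) - \<psi> 0\<bar> * \<bar>\<tau>\<bar>"
        by (metis abs_ge_self abs_mult)
      also have "\<dots> \<le> (M * \<bar>r * \<tau>\<bar>) * \<bar>\<tau>\<bar>"
        using lip by (intro mult_right_mono) auto
      also have "\<dots> = M * \<tau>\<^sup>2 * r" using r by (simp add: abs_mult power2_eq_square)
      finally show ?thesis .
    qed
    ultimately show "\<exists>y. (\<theta> has_real_derivative y) (at r) \<and> y \<le> 0"
      by (intro exI conjI) (auto simp: algebra_simps)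
  qed simp
  then show ?thesis by (simp add: \<theta>_def)
qed

text \<open>Nonnegativity at \<open>-\<tau>\<close> bounds the slope at \<open>0\<close>, which is then inserted into the quadratic
  upper bound at \<open>1\<close>.\<close>

lemma nonneg_smooth_growth:
  fixes \<phi> \<psi> :: "real \<Rightarrow> real"
  assumes deriv: "\<And>t. (\<phi> has_real_derivative \<psi> t) (at t)"
    and lip: "\<And>t. \<bar>\<psi> t - \<psi> 0\<bar> \<le> M * \<bar>t\<bar>"
    and nonneg: "\<And>t. 0 \<le> \<phi> t" and \<tau>: "\<tau> > 0"
  shows "\<phi> 1 \<le> (1 + 1 / \<tau>) * \<phi> 0 + (1 + \<tau>) * M / 2"
proof -
  have "0 \<le> \<phi> 0 + (- \<tau>) * \<psi> 0 + M * (- \<tau>)\<^sup>2 / 2"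
    using nonneg quadratic_upper_bound[OF deriv lip] by (meson order_trans)
  then have "\<psi> 0 \<le> \<phi> 0 / \<tau> + M * \<tau> / 2"
    using \<tau> by (simp add: field_simps power2_eq_square)
  moreover have "\<phi> 1 \<le> \<phi> 0 + \<psi> 0 + M / 2"
    using quadratic_upper_bound[OF deriv lip, of 1] by simp
  ultimately show ?thesis by (simp add: algebra_simps add_divide_distrib)
qed

text \<open>The gradient is a derivative within \<open>E\<close> only, but the whole line lies in
  \<open>E\<close>, so the chain rule still yields an ordinary derivative in \<open>t\<close>. One
  factor \<open>norm d\<close> comes from the direction, the other from the distance between the two
  points.\<close>

lemma lipschitz_gradient_on_line:
  assumes E: "subspace E" and g: "has_lipschitz_gradient_on L E g"
    and l: "l \<in> E" and d: "d \<in> E"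
  obtains \<psi> where "\<And>t. ((\<lambda>t. g (l + t *\<^sub>R d)) has_real_derivative \<psi> t) (at t)"
    and "\<And>t. \<bar>\<psi> t - \<psi> 0\<bar> \<le> L * (norm d)\<^sup>2 * \<bar>t\<bar>"
proof -
  obtain G where G: "\<And>l. l \<in> E \<Longrightarrow> (g has_derivative (\<lambda>h. G l \<bullet> h)) (at l within E)"
    and lip: "L-lipschitz_on E G"
    using g unfolding has_lipschitz_gradient_on_def by blast
  have mem: "l + t *\<^sub>R d \<in> E" for t
    using E l d by (simp add: subspace_add subspace_scale)
  show thesis
  proof
    fix t :: real
    have 1: "(g has_derivative (\<lambda>h. G (l + t *\<^sub>R d) \<bullet> h)) (at (l + t *\<^sub>R d) within range (\<lambda>t. l + t *\<^sub>R d))"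
      using G[OF mem] by (rule has_derivative_subset) (use mem in auto)
    have 2: "((\<lambda>t. l + t *\<^sub>R d) has_derivative (\<lambda>h. h *\<^sub>R d)) (at t)"
      by (auto intro!: derivative_eq_intros)
    show "((\<lambda>t. g (l + t *\<^sub>R d)) has_real_derivative G (l + t *\<^sub>R d) \<bullet> d) (at t)"
      using diff_chain_within[OF 2 1]
      by (simp add: has_field_derivative_def o_def mult_commute_abs)
    have "\<bar>G (l + t *\<^sub>R d) \<bullet> d - G (l + 0 *\<^sub>R d) \<bullet> d\<bar> \<le> norm (G (l + t *\<^sub>R d) - G l) * norm d"
      using Cauchy_Schwarz_ineq2[of "G (l + t *\<^sub>R d) - G l" d] by (simp add: inner_diff_left)
    also have "\<dots> \<le> (L * norm (t *\<^sub>R d)) * norm d"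
      using lipschitz_onD[OF lip mem l, of t] by (intro mult_right_mono) (simp_all add: dist_norm)
    finally show "\<bar>G (l + t *\<^sub>R d) \<bullet> d - G (l + 0 *\<^sub>R d) \<bullet> d\<bar> \<le> L * (norm d)\<^sup>2 * \<bar>t\<bar>"
      by (simp add: power2_eq_square mult_ac)
  qed
qed

section \<open>Orthonormal coordinates as an isometry onto the direction space\<close>

lemma subspace_coord_space: "subspace (coord_space K)"
  by (auto simp: subspace_def coord_space_def)

lemma linear_coord_inv: "linear (coord_inv K v)"
  unfolding coord_inv_def
  by (rule linearI) (simp_all add: scaleR_add_left sum.distrib scaleR_sum_right)

lemma norm_coord_inv:
  assumes on: "orthonormal_basis_on K v V" and l: "l \<in> coord_space K"
  shows "norm (coord_inv K v l) = norm l"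
proof -
  have "coord_inv K v l \<bullet> coord_inv K v l = (\<Sum>i\<in>K. \<Sum>j\<in>K. l $ i * (l $ j * (v i \<bullet> v j)))"
    unfolding coord_inv_def inner_sum_left inner_sum_right
    by (subst sum.swap) (simp add: mult.left_commute inner_commute)
  also have "\<dots> = (\<Sum>i\<in>K. \<Sum>j\<in>K. if j = i then l $ i * l $ j else 0)"
    using on by (intro sum.cong refl) (auto simp: orthonormal_basis_on_def)
  also have "\<dots> = (\<Sum>i\<in>K. l $ i * l $ i)" by simp
  also have "\<dots> = l \<bullet> l"
    unfolding inner_vec_def
    by (rule sum.mono_neutral_cong_left) (use l in \<open>auto simp: coord_space_def\<close>)
  finally show ?thesis by (simp add: norm_eq_sqrt_inner)
qed

lemma coord_inv_image:
  assumes on: "orthonormal_basis_on K v V"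
  shows "coord_inv K v ` coord_space K = V"
proof
  have V: "V = span (v ` K)" using on by (simp add: orthonormal_basis_on_def)
  show "coord_inv K v ` coord_space K \<subseteq> V"
    by (auto simp: V coord_inv_def intro: span_sum span_scale span_base)
  have "subspace (coord_inv K v ` coord_space K)"
    by (intro linear_subspace_image linear_coord_inv subspace_coord_space)
  moreover have "v ` K \<subseteq> coord_inv K v ` coord_space K"
  proof
    fix w assume "w \<in> v ` K"
    then obtain i where i: "i \<in> K" "w = v i" by auto
    have "coord_inv K v (axis i 1) = (\<Sum>j\<in>K. if j = i then v j else 0)"
      unfolding coord_inv_def by (intro sum.cong) (auto simp: axis_def)
    then have "w = coord_inv K v (axis i 1)" using i by simp
    moreover have "axis i 1 \<in> coord_space K" using i by (auto simp: coord_space_def axis_def)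
    ultimately show "w \<in> coord_inv K v ` coord_space K" by blast
  qed
  ultimately show "V \<subseteq> coord_inv K v ` coord_space K"
    unfolding V by (rule span_minimal[rotated])
qed

text \<open>Pulled back to coordinates, the line through \<open>q\<close> and \<open>a\<close> has
  direction of norm \<open>norm (a - q)\<close>, and subtracting the linear term
  \<open>x \<bullet> \<nu>\<close> leaves the Lipschitz constant of the slope unchanged. Since
  \<open>D\<close> is a translate of a subspace, it contains the entire line, including the points
  beyond \<open>q\<close> at which nonnegativity is exploited.\<close>

lemma affine_smooth_growth:
  fixes F :: "'a::real_inner \<Rightarrow> real"
  assumes on: "orthonormal_basis_on K v ((\<lambda>\<mu>. \<mu> - \<mu>0) ` D)"
    and g: "has_lipschitz_gradient_on L (coord_space K) (\<lambda>l. F (\<mu>0 + coord_inv K v l))"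
    and q: "q \<in> D" and a: "a \<in> D" and \<tau>: "\<tau> > 0"
    and nonneg: "\<And>\<nu>. \<nu> \<in> D \<Longrightarrow> 0 \<le> F \<nu> + r - x \<bullet> \<nu>"
  shows "F a + r - x \<bullet> a \<le> (1 + 1 / \<tau>) * (F q + r - x \<bullet> q) + (1 + \<tau>) * (L * (norm (a - q))\<^sup>2) / 2"
proof -
  let ?c = "coord_inv K v" and ?E = "coord_space K"
  note img = coord_inv_image[OF on]
  have "q - \<mu>0 \<in> ?c ` ?E" "a - \<mu>0 \<in> ?c ` ?E" using q a by (auto simp: img)
  then obtain lq la where l: "lq \<in> ?E" "la \<in> ?E" "q - \<mu>0 = ?c lq" "a - \<mu>0 = ?c la" by auto
  have dE: "la - lq \<in> ?E" using l by (simp add: subspace_diff subspace_coord_space)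
  have "?c (la - lq) = a - q"
    unfolding linear_diff[OF linear_coord_inv] l(3,4)[symmetric] by simp
  then have dn: "norm (la - lq) = norm (a - q)" using norm_coord_inv[OF on dE] by simp
  obtain \<psi> where
    \<psi>: "\<And>t. ((\<lambda>t. F (\<mu>0 + ?c (lq + t *\<^sub>R (la - lq)))) has_real_derivative \<psi> t) (at t)"
       "\<And>t. \<bar>\<psi> t - \<psi> 0\<bar> \<le> L * (norm (la - lq))\<^sup>2 * \<bar>t\<bar>"
    using lipschitz_gradient_on_line[OF subspace_coord_space g l(1) dE] by blast
  have line: "\<mu>0 + ?c (lq + t *\<^sub>R (la - lq)) = q + t *\<^sub>R (a - q)" for t
    unfolding linear_add[OF linear_coord_inv] linear_scale[OF linear_coord_inv]
      \<open>?c (la - lq) = a - q\<close> l(3)[symmetric] by simp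
  have mem: "q + t *\<^sub>R (a - q) \<in> D" for t
  proof -
    have "lq + t *\<^sub>R (la - lq) \<in> ?E"
      using l(1) dE by (simp add: subspace_add subspace_scale subspace_coord_space)
    then have "?c (lq + t *\<^sub>R (la - lq)) \<in> (\<lambda>\<mu>. \<mu> - \<mu>0) ` D" unfolding img[symmetric] by blast
    then show ?thesis unfolding line[symmetric] by auto
  qed
  define \<phi> where "\<phi> t = F (q + t *\<^sub>R (a - q)) + r - x \<bullet> (q + t *\<^sub>R (a - q))" for t
  have "\<phi> 1 \<le> (1 + 1 / \<tau>) * \<phi> 0 + (1 + \<tau>) * (L * (norm (a - q))\<^sup>2) / 2"
  proof (rule nonneg_smooth_growth[where \<psi> = "\<lambda>t. \<psi> t - x \<bullet> (a - q)"])
    show "(\<phi> has_real_derivative \<psi> t - x \<bullet> (a - q)) (at t)" for t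
      using \<psi>(1)[of t] unfolding \<phi>_def line inner_add_right inner_scaleR_right
      by (auto intro!: derivative_eq_intros)
    show "0 \<le> \<phi> t" for t unfolding \<phi>_def by (rule nonneg[OF mem])
  qed (use \<psi>(2) dn \<tau> in auto)
  then show ?thesis by (simp add: \<phi>_def)
qed

section \<open>Conjugates and their domains\<close>

lemma fenchel_young:
  assumes "x \<in> S"
  shows "ereal (\<mu> \<bullet> x) - f x \<le> fenchel_conjugate_on S f \<mu>"
  unfolding fenchel_conjugate_on_def using assms by (rule SUP_upper)

text \<open>A conjugate is a supremum of functions continuous in the dual variable, so a uniform
  bound passes to limits term by term.\<close>

lemma fenchel_conjugate_on_le_limit:
  assumes \<mu>: "\<mu> \<longlonglongrightarrow> \<nu>" and B: "\<And>n. fenchel_conjugate_on S f (\<mu> n) \<le> ereal B"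
  shows "fenchel_conjugate_on S f \<nu> \<le> ereal B"
  unfolding fenchel_conjugate_on_def
proof (rule SUP_least)
  fix x assume x: "x \<in> S"
  have le: "ereal (\<mu> n \<bullet> x) - f x \<le> ereal B" for n
    using fenchel_young[OF x] B by (rule order_trans)
  show "ereal (\<nu> \<bullet> x) - f x \<le> ereal B"
  proof (cases "f x")
    case (real r)
    have "(\<lambda>n. \<mu> n \<bullet> x - r) \<longlonglongrightarrow> \<nu> \<bullet> x - r" by (intro tendsto_intros \<mu>)
    moreover have "\<mu> n \<bullet> x - r \<le> B" for n using le[of n] real by simp
    ultimately have "\<nu> \<bullet> x - r \<le> B" by (intro LIMSEQ_le_const2) auto
    then show ?thesis using real by simp
  \<comment> \<open>For infinite \<open>f x\<close> the term does not depend on the dual point, so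
    the bound at index 0 carries over.\<close>
  qed (use le[of 0] in auto)
qed

text \<open>Along a convergent sequence in the domain the Lipschitz bound keeps the values bounded,
  and lower semicontinuity of the conjugate then keeps the value at the limit below
  \<open>\<infinity>\<close>.\<close>

lemma closed_dom_lipschitz_conjugate:
  fixes S :: "'a::euclidean_space set"
  assumes S: "closed S" and lip: "L-lipschitz_on (dom_on S fc) (\<lambda>\<mu>. real_of_ereal (fc \<mu>))"
    and fc: "fc = fenchel_conjugate_on S f" and notM: "\<And>\<mu>. \<mu> \<in> dom_on S fc \<Longrightarrow> fc \<mu> \<noteq> -\<infinity>"
  shows "closed (dom_on S fc)"
  unfolding closed_sequential_limits
proof safe
  fix \<mu> \<nu> assume mem: "\<forall>n. \<mu> n \<in> dom_on S fc" and lim: "\<mu> \<longlonglongrightarrow> \<nu>"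
  \<comment> \<open>\<open>real_of_ereal\<close> sends infinite values to 0, so the Lipschitz
    hypothesis speaks about \<open>fc\<close> itself only once its values are known to be
    finite.\<close>
  have fin: "fc (\<mu> n) = ereal (real_of_ereal (fc (\<mu> n)))" for n
    using mem[rule_format, of n] notM[OF mem[rule_format, of n]]
    by (cases "fc (\<mu> n)") (auto simp: dom_on_def)
  have "Bseq (\<lambda>n. \<mu> n - \<mu> 0)"
    by (intro convergent_imp_Bseq convergentI[of _ "\<nu> - \<mu> 0"] tendsto_intros lim)
  then obtain C where C: "\<And>n. norm (\<mu> n - \<mu> 0) \<le> C" by (auto simp: Bseq_def)
  have "fc (\<mu> n) \<le> ereal (real_of_ereal (fc (\<mu> 0)) + L * C)" for n
  proof -
    have "\<bar>real_of_ereal (fc (\<mu> n)) - real_of_ereal (fc (\<mu> 0))\<bar> \<le> L * norm (\<mu> n - \<mu> 0)"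
      using lipschitz_onD[OF lip, of "\<mu> n" "\<mu> 0"] mem by (simp add: dist_norm)
    also have "\<dots> \<le> L * C" using C lipschitz_on_nonneg[OF lip] by (intro mult_left_mono)
    finally show ?thesis by (subst fin) simp
  qed
  then have "fc \<nu> \<le> ereal (real_of_ereal (fc (\<mu> 0)) + L * C)"
    using fenchel_conjugate_on_le_limit[OF lim] unfolding fc by blast
  moreover have "\<nu> \<in> S"
    using S mem lim unfolding closed_sequential_limits dom_on_def by blast
  ultimately show "\<nu> \<in> dom_on S fc" by (auto simp: dom_on_def)
qed

lemma convex_dom_conjugate:
  assumes "proper f"
  shows "convex (dom_on UNIV (fenchel_conjugate f))"
  unfolding convex_alt
proof (intro ballI allI impI)
  fix \<mu> \<nu> and t :: real
  assume dom: "\<mu> \<in> dom_on UNIV (fenchel_conjugate f)" "\<nu> \<in> dom_on UNIV (fenchel_conjugate f)"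
    and t: "0 \<le> t \<and> t \<le> 1"
  have "\<exists>B. fenchel_conjugate f \<xi> \<le> ereal B" if "fenchel_conjugate f \<xi> < \<infinity>" for \<xi>
    using that by (cases "fenchel_conjugate f \<xi>") auto
  then obtain B C where BC: "fenchel_conjugate f \<mu> \<le> ereal B" "fenchel_conjugate f \<nu> \<le> ereal C"
    using dom unfolding dom_on_def by blast
  have "fenchel_conjugate f ((1 - t) *\<^sub>R \<mu> + t *\<^sub>R \<nu>) \<le> ereal ((1 - t) * B + t * C)"
    unfolding fenchel_conjugate_on_def
  proof (rule SUP_least)
    fix x
    have *: "ereal (\<mu> \<bullet> x) - f x \<le> ereal B" "ereal (\<nu> \<bullet> x) - f x \<le> ereal C"
      using fenchel_young[OF UNIV_I] BC order_trans by blast+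
    show "ereal (((1 - t) *\<^sub>R \<mu> + t *\<^sub>R \<nu>) \<bullet> x) - f x \<le> ereal ((1 - t) * B + t * C)"
    proof (cases "f x")
      case (real r)
      then have "(1 - t) * (\<mu> \<bullet> x - r) \<le> (1 - t) * B" "t * (\<nu> \<bullet> x - r) \<le> t * C"
        using * t by (auto intro!: mult_left_mono)
      then show ?thesis using real by (simp add: inner_add_left algebra_simps)
    qed (use assms in \<open>auto simp: proper_def\<close>)
  qed
  then show "(1 - t) *\<^sub>R \<mu> + t *\<^sub>R \<nu> \<in> dom_on UNIV (fenchel_conjugate f)"
    by (auto simp: dom_on_def)
qed

section \<open>Orthogonal sums and the choice of weights\<close>

lemma norm_orthogonal_parts_le:
  assumes "orthogonal_decomposition X1 X2" "u \<in> X1" "w \<in> X2"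
  shows "norm u \<le> norm (u + w)" "norm w \<le> norm (u + w)"
proof -
  have "(norm (u + w))\<^sup>2 = (norm u)\<^sup>2 + (norm w)\<^sup>2"
    using assms by (intro norm_add_Pythagorean) (auto simp: orthogonal_decomposition_def)
  then show "norm u \<le> norm (u + w)" "norm w \<le> norm (u + w)"
    by (simp_all add: power2_le_imp_le)
qed

text \<open>Sums of closed sets need not be closed in general. Here each component is dominated in
  norm by the sum, so convergence of the sums forces convergence of both components.\<close>

lemma closed_orthogonal_sum:
  fixes X1 X2 :: "'a::euclidean_space set"
  assumes dec: "orthogonal_decomposition X1 X2" and sub: "D1 \<subseteq> X1" "D2 \<subseteq> X2"
    and cl: "closed D1" "closed D2"
  shows "closed {u + w |u w. u \<in> D1 \<and> w \<in> D2}"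
  unfolding closed_sequential_limits
proof (intro allI impI, elim conjE)
  fix \<mu> \<nu> assume mem: "\<forall>n. \<mu> n \<in> {u + w |u w. u \<in> D1 \<and> w \<in> D2}" and lim: "\<mu> \<longlonglongrightarrow> \<nu>"
  have "\<forall>n. \<exists>u w. u \<in> D1 \<and> w \<in> D2 \<and> \<mu> n = u + w" using mem by blast
  then obtain u w where uw: "\<And>n. u n \<in> D1" "\<And>n. w n \<in> D2" "\<And>n. \<mu> n = u n + w n" by metis
  obtain u' w' where \<nu>: "u' \<in> X1" "w' \<in> X2" "\<nu> = u' + w'"
    using dec by (auto simp: orthogonal_decomposition_def) blast
  have "u n - u' \<in> X1" "w n - w' \<in> X2" for n
    using dec uw \<nu> sub by (auto simp: orthogonal_decomposition_def intro!: subspace_diff)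
  note le = norm_orthogonal_parts_le[OF dec this]
  have "(\<lambda>n. norm (\<mu> n - \<nu>)) \<longlonglongrightarrow> 0" using lim by (simp add: LIM_zero tendsto_norm_zero)
  moreover have "norm (u n - u') \<le> norm (\<mu> n - \<nu>)" "norm (w n - w') \<le> norm (\<mu> n - \<nu>)" for n
    using le[of n n] uw \<nu> by (simp_all add: add_diff_add)
  ultimately have "(\<lambda>n. u n - u') \<longlonglongrightarrow> 0" "(\<lambda>n. w n - w') \<longlonglongrightarrow> 0"
    by (auto elim!: Lim_null_comparison[rotated])
  then have "u \<longlonglongrightarrow> u'" "w \<longlonglongrightarrow> w'" by (simp_all add: LIM_zero_iff)
  then have "u' \<in> D1" "w' \<in> D2" using cl uw unfolding closed_sequential_limits by blast+
  then show "\<nu> \<in> {u + w |u w. u \<in> D1 \<and> w \<in> D2}" using \<nu> by blast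
qed

text \<open>With \<open>\<kappa> = \<beta> * L\<close>, this \<open>\<tau>\<close> gives
  \<open>1 + 1 / \<tau> = 2 + \<kappa>\<close> and \<open>(1 + \<tau>) * \<kappa> = (2 + \<kappa>) *
  \<kappa> / (1 + \<kappa>)\<close>. Both are at most \<open>2 + \<kappa>\<close>, so
  \<open>e\<close> and \<open>G - e\<close> get a common weight and add up to
  \<open>G\<close>.\<close>

lemma smoothness_weight_bound:
  fixes e G \<beta> L N :: real
  assumes "0 < \<beta>" "0 \<le> L" "0 \<le> e" "e + N\<^sup>2 / (2 * \<beta>) \<le> G" "d\<^sup>2 \<le> N\<^sup>2"
  defines "\<tau> \<equiv> 1 / (1 + \<beta> * L)"
  shows "(1 + 1 / \<tau>) * e + (1 + \<tau>) * (L * d\<^sup>2) / 2 \<le> (2 + \<beta> * L) * G"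
proof -
  define \<kappa> where "\<kappa> = \<beta> * L"
  have \<kappa>: "\<kappa> \<ge> 0" and \<tau>: "\<tau> = 1 / (1 + \<kappa>)" using assms by (simp_all add: \<kappa>_def)
  have "d\<^sup>2 \<le> 2 * \<beta> * (G - e)" using assms by (simp add: field_simps)
  then have "L * d\<^sup>2 / 2 \<le> \<kappa> * (G - e)"
    using mult_left_mono[of "d\<^sup>2" "2 * \<beta> * (G - e)" L] assms by (simp add: \<kappa>_def algebra_simps)
  then have "(1 + \<tau>) * (L * d\<^sup>2 / 2) \<le> (1 + \<tau>) * (\<kappa> * (G - e))"
    using \<kappa> by (intro mult_left_mono) (auto simp: \<tau>)
  also have "\<dots> = ((1 + \<tau>) * \<kappa>) * (G - e)" by simp
  also have "\<dots> \<le> (2 + \<kappa>) * (G - e)"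
  proof (rule mult_right_mono)
    show "(1 + \<tau>) * \<kappa> \<le> 2 + \<kappa>"
      using \<kappa> by (simp add: \<tau> field_simps)
    have "0 \<le> N\<^sup>2 / (2 * \<beta>)" using assms by simp
    then show "0 \<le> G - e" using assms by linarith
  qed
  finally have "(1 + \<tau>) * (L * d\<^sup>2 / 2) \<le> (2 + \<kappa>) * (G - e)" .
  moreover have "1 + 1 / \<tau> = 2 + \<kappa>" using \<tau> by simp
  ultimately show ?thesis
    unfolding \<kappa>_def[symmetric] by (simp add: right_diff_distrib)
qed

section \<open>The gap estimate\<close>

text \<open>\<open>T\<close> stands for the signed duality gap, \<open>h\<close> for a Fenchel-Young
  gap, \<open>N\<close> and \<open>R\<close> for the norms of \<open>s\<close> and of
  \<open>A x - b\<close>, and \<open>\<alpha>\<close> for the distance to the projection. Each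
  nonnegative summand of \<open>G\<close> is at most \<open>G\<close>, which bounds \<open>N\<close>
  and \<open>R\<close> by multiples of \<open>sqrt G\<close>.\<close>

lemma projected_gap_real_bound:
  fixes e G T h N R \<alpha> nx ny L1 \<kappa> \<beta>x \<beta>y :: real
  assumes \<beta>: "\<beta>x > 0" "\<beta>y > 0" and e: "0 \<le> e" and N: "0 \<le> N"
    and G: "G = e + N\<^sup>2 / (2 * \<beta>x) + R\<^sup>2 / (2 * \<beta>y)"
    and h: "0 \<le> h" "h \<le> (2 + \<kappa>) * G"
    and T: "\<bar>T - h\<bar> \<le> L1 * N + 2 * nx * N + R * ny"
    and nonneg: "0 \<le> L1" "0 \<le> nx" "0 \<le> ny" and \<alpha>: "\<bar>\<alpha>\<bar> \<le> N"
  shows "T\<^sup>2 + \<alpha>\<^sup>2 + R\<^sup>2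
    \<le> ((3 + \<kappa>) * G + (sqrt (2 * \<beta>x) * (2 * nx + L1) + sqrt (2 * \<beta>y) * ny) * sqrt G)\<^sup>2
       + 2 * max \<beta>x \<beta>y * G"
proof -
  define m where "m = max \<beta>x \<beta>y"
  have m: "m \<ge> \<beta>x" "m \<ge> \<beta>y" "m > 0" using \<beta> by (auto simp: m_def)
  have quo: "0 \<le> N\<^sup>2 / (2 * \<beta>x)" "0 \<le> R\<^sup>2 / (2 * \<beta>y)" using \<beta> by simp_all
  then have G0: "0 \<le> G" using G e by linarith
  have "N\<^sup>2 / (2 * \<beta>x) \<le> G" "R\<^sup>2 / (2 * \<beta>y) \<le> G" using quo G e by linarith+
  then have "N\<^sup>2 \<le> 2 * \<beta>x * G" "R\<^sup>2 \<le> 2 * \<beta>y * G"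
    using \<beta> by (simp_all add: field_simps)
  then have NR: "N \<le> sqrt (2 * \<beta>x) * sqrt G" "R \<le> sqrt (2 * \<beta>y) * sqrt G"
    by (simp_all add: real_le_rsqrt flip: real_sqrt_mult)
  have "N\<^sup>2 = 2 * \<beta>x * (N\<^sup>2 / (2 * \<beta>x))" "R\<^sup>2 = 2 * \<beta>y * (R\<^sup>2 / (2 * \<beta>y))"
    using \<beta> by simp_all
  moreover have "2 * \<beta>x * (N\<^sup>2 / (2 * \<beta>x)) \<le> 2 * m * (N\<^sup>2 / (2 * \<beta>x))"
      "2 * \<beta>y * (R\<^sup>2 / (2 * \<beta>y)) \<le> 2 * m * (R\<^sup>2 / (2 * \<beta>y))"
    by (intro mult_right_mono quo; use m in simp)+
  moreover have "2 * m * (N\<^sup>2 / (2 * \<beta>x)) + 2 * m * (R\<^sup>2 / (2 * \<beta>y)) \<le> 2 * m * G"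
  proof -
    have "2 * m * (N\<^sup>2 / (2 * \<beta>x) + R\<^sup>2 / (2 * \<beta>y)) \<le> 2 * m * G"
      using G e m by (intro mult_left_mono) auto
    then show ?thesis by (simp only: distrib_left)
  qed
  \<comment> \<open>The two squares are added before comparing with \<open>G\<close>; bounding them
    separately would cost \<open>2 * m * G\<close> twice.\<close>
  ultimately have "N\<^sup>2 + R\<^sup>2 \<le> 2 * m * G" by linarith
  moreover have "\<alpha>\<^sup>2 \<le> N\<^sup>2" using \<alpha> N by (simp add: abs_le_square_iff[symmetric])
  ultimately have feas: "\<alpha>\<^sup>2 + R\<^sup>2 \<le> 2 * m * G" by linarith
  have "\<bar>T\<bar> \<le> (2 + \<kappa>) * G + (L1 * N + 2 * nx * N + R * ny)"
    using T h by linarith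
  also have "\<dots> = (2 + \<kappa>) * G + ((2 * nx + L1) * N + ny * R)" by (simp add: algebra_simps)
  also have "\<dots> \<le> (3 + \<kappa>) * G
      + ((2 * nx + L1) * (sqrt (2 * \<beta>x) * sqrt G) + ny * (sqrt (2 * \<beta>y) * sqrt G))"
    using nonneg G0 by (intro add_mono mult_right_mono mult_left_mono NR) auto
  also have "\<dots> = (3 + \<kappa>) * G + (sqrt (2 * \<beta>x) * (2 * nx + L1) + sqrt (2 * \<beta>y) * ny) * sqrt G"
    by (simp add: algebra_simps)
  finally have "\<bar>T\<bar> \<le> (3 + \<kappa>) * G + (sqrt (2 * \<beta>x) * (2 * nx + L1) + sqrt (2 * \<beta>y) * ny) * sqrt G" .
  then have "T\<^sup>2 \<le> ((3 + \<kappa>) * G + (sqrt (2 * \<beta>x) * (2 * nx + L1) + sqrt (2 * \<beta>y) * ny) * sqrt G)\<^sup>2"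
    by (metis abs_ge_zero power2_abs power_mono)
  then show ?thesis using feas by (simp add: m_def)
qed

text \<open>Minimality of \<open>xs\<close> for the Lagrangian at \<open>ys\<close> makes
  \<open>- adjoint A ys\<close> a subgradient of \<open>f\<close> at \<open>xs\<close>. The
  resulting minorant gives existence of proximal points, and the finite conjugate bound a point in
  the domain to project onto.\<close>

lemma saddle_point_minorant:
  fixes A :: "'a::euclidean_space \<Rightarrow> 'b::euclidean_space"
  assumes f: "proper f" and A: "linear A" and sp: "saddle_point f A b xs ys"
  obtains c where "\<And>z. ereal ((- adjoint A ys) \<bullet> z - c) \<le> f z"
    and "fenchel_conjugate f (- adjoint A ys) < \<infinity>"
proof -
  have notM: "f z \<noteq> -\<infinity>" for z using f by (simp add: proper_def)
  have le: "f xs + ereal ((A xs - b) \<bullet> ys) \<le> f z + ereal ((A z - b) \<bullet> ys)" for z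
    using sp by (simp add: saddle_point_def)
  obtain z0 where z0: "f z0 \<noteq> \<infinity>" using f by (auto simp: proper_def)
  then obtain r where r: "f xs = ereal r"
    using le[of z0] notM[of xs] notM[of z0] by (cases "f xs"; cases "f z0") auto
  define c where "c = - (r + A xs \<bullet> ys)"
  have adj: "adjoint A ys \<bullet> z = A z \<bullet> ys" for z
    using adjoint_works[OF A, of z ys] by (simp add: inner_commute)
  have minorant: "ereal ((- adjoint A ys) \<bullet> z - c) \<le> f z" for z
    using le[of z] notM[of z] r by (cases "f z") (auto simp: c_def adj inner_diff_left)
  moreover have "fenchel_conjugate f (- adjoint A ys) \<le> ereal c"
    unfolding fenchel_conjugate_on_def
  proof (rule SUP_least)
    fix z show "ereal ((- adjoint A ys) \<bullet> z) - f z \<le> ereal c"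
      using minorant[of z] notM[of z] by (cases "f z") auto
  qed
  then have "fenchel_conjugate f (- adjoint A ys) < \<infinity>"
    by (cases "fenchel_conjugate f (- adjoint A ys)") auto
  ultimately show thesis by (rule that)
qed

theorem theorem8:
  fixes f :: "'a::euclidean_space \<Rightarrow> ereal"
    and A :: "'a \<Rightarrow> 'b::euclidean_space" and b :: 'b
    and x :: 'a and y :: 'b
    and \<beta>x \<beta>y L1 Lg :: real
    and X1 X2 :: "'a set" and f1 f2 :: "'a \<Rightarrow> ereal"
    and \<mu>0 :: 'a and K :: "'k::finite set" and v :: "'k \<Rightarrow> 'a"
  defines "f1c \<equiv> fenchel_conjugate_on X1 f1"
    and "f2c \<equiv> fenchel_conjugate_on X2 f2"
  assumes "\<beta>x > 0" and "\<beta>y > 0"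
    and "f \<in> Gamma0" and "linear A"
    and "\<exists>xs ys. saddle_point f A b xs ys"
    and "orthogonal_decomposition X1 X2"
    and "\<forall>\<mu>1\<in>X1. \<forall>\<mu>2\<in>X2. fenchel_conjugate f (\<mu>1 + \<mu>2) = f1c \<mu>1 + f2c \<mu>2"
    and "L1-lipschitz_on (dom_on X1 f1c) (\<lambda>\<mu>. real_of_ereal (f1c \<mu>))"
    and "dom_on X2 f2c \<noteq> {}" and "affine (dom_on X2 f2c)"
    and "\<mu>0 \<in> dom_on X2 f2c"
    and "orthonormal_basis_on K v ((\<lambda>\<mu>. \<mu> - \<mu>0) ` dom_on X2 f2c)"
    and "has_lipschitz_gradient_on Lg (coord_space K)
           (\<lambda>l. real_of_ereal (f2c (\<mu>0 + coord_inv K v l)))"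
  shows "projected_gap f A b x y \<le>
     (ereal (3 + \<beta>x * Lg) * smoothed_gap f A b \<beta>x \<beta>y x y
      + ereal (sqrt (2 * \<beta>x) * (2 * norm x + L1) + sqrt (2 * \<beta>y) * norm y)
        * ereal_sqrt (smoothed_gap f A b \<beta>x \<beta>y x y))\<^sup>2
     + ereal (2 * max \<beta>x \<beta>y) * smoothed_gap f A b \<beta>x \<beta>y x y"
proof -
  note \<beta> = assms(3,4) and f = assms(5) and A = assms(6) and dec = assms(8)
    and sep = assms(9)[rule_format] and lip = assms(10) and smooth = assms(14,15)
  have proper: "proper f" using f by (simp add: Gamma0_def)
  have notM: "f z \<noteq> -\<infinity>" for z using proper by (simp add: proper_def)
  obtain xs ys where "saddle_point f A b xs ys" using assms(7) by blast
  then obtain w c where minorant: "\<And>z. ereal (w \<bullet> z - c) \<le> f z"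
    and w: "fenchel_conjugate f w < \<infinity>"
    using saddle_point_minorant[OF proper A] by metis
  define p where "p = prox (inverse \<beta>x) f (x - (1 / \<beta>x) *\<^sub>R adjoint A y)"
  define s where "s = \<beta>x *\<^sub>R (x - p)"
  define q where "q = s - adjoint A y"
  have pu: "(1 / inverse \<beta>x) *\<^sub>R (x - (1 / \<beta>x) *\<^sub>R adjoint A y - p) = q"
    using \<beta> by (simp add: q_def s_def algebra_simps divide_inverse)
  have i\<beta>: "inverse \<beta>x > 0" using \<beta> by simp
  note sub = prox_subgradient[OF f minorant i\<beta>, of "x - (1 / \<beta>x) *\<^sub>R adjoint A y",
      folded p_def, unfolded pu]
  obtain fp where fp: "f p = ereal fp" using sub(1) by auto
  have gap: "smoothed_gap f A b \<beta>x \<beta>y x y = f x - ereal fp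
      + ereal (A (x - p) \<bullet> y - \<beta>x / 2 * (norm (p - x))\<^sup>2 + 1 / (2 * \<beta>y) * (norm (A x - b))\<^sup>2)"
    unfolding smoothed_gap_def Let_def p_def[symmetric] fp ..
  have Lg: "0 \<le> Lg"
    using smooth(2) lipschitz_on_nonneg unfolding has_lipschitz_gradient_on_def by blast
  have L1: "0 \<le> L1" using lip lipschitz_on_nonneg by blast
  show ?thesis
  proof (cases "f x = \<infinity>")
    \<comment> \<open>The smoothed gap is then infinite, and the positive coefficient
      \<open>3 + \<beta>x * Lg\<close> makes the right-hand side infinite too.\<close>
    case True
    have "3 + \<beta>x * Lg > 0" using \<beta> Lg by (simp add: add_pos_nonneg)
    then show ?thesis using True \<beta> by (simp add: gap power2_eq_square)
  next
    case False
    then obtain fx where fx: "f x = ereal fx" using notM[of x] by (cases "f x") auto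
    have conj_notM: "fenchel_conjugate f \<mu> \<noteq> -\<infinity>" for \<mu>
      using fenchel_young[of x UNIV \<mu> f] fx by auto
    define D where "D = dom_on UNIV (fenchel_conjugate f)"
    define D1 where "D1 = dom_on X1 f1c"
    define D2 where "D2 = dom_on X2 f2c"
    define F1 where "F1 \<mu> = real_of_ereal (f1c \<mu>)" for \<mu>
    define F2 where "F2 \<mu> = real_of_ereal (f2c \<mu>)" for \<mu>
    \<comment> \<open>A value \<open>-\<infinity>\<close> of one component would, next to a domain
      point of the other, force the full conjugate to \<open>-\<infinity>\<close>.\<close>
    have fin_or_M: "f1c \<mu> \<noteq> -\<infinity>" "f2c \<nu> \<noteq> -\<infinity>" if "\<mu> \<in> D1" "\<nu> \<in> D2" for \<mu> \<nu>
      using that sep[of \<mu> \<nu>] conj_notM[of "\<mu> + \<nu>"]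
      unfolding D1_def D2_def dom_on_def by (cases "f1c \<mu>"; cases "f2c \<nu>"; simp)+
    \<comment> \<open>In \<open>ereal\<close> the sum of \<open>\<infinity>\<close> and
      \<open>-\<infinity>\<close> is \<open>\<infinity>\<close>, so a sum lies below
      \<open>\<infinity>\<close> exactly when both summands do.\<close>
    have D_mem: "u + w \<in> D \<longleftrightarrow> u \<in> D1 \<and> w \<in> D2" if "u \<in> X1" "w \<in> X2" for u w
      using that sep[of u w] unfolding D_def D1_def D2_def dom_on_def
      by (cases "f1c u"; cases "f2c w") auto
    have parts: "\<exists>u w. u \<in> D1 \<and> w \<in> D2 \<and> \<mu> = u + w" if "\<mu> \<in> D" for \<mu>
    proof -
      obtain u w where "u \<in> X1" "w \<in> X2" "\<mu> = u + w"
        using dec unfolding orthogonal_decomposition_def by metis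
      then show ?thesis using D_mem that by blast
    qed
    have sub12: "D1 \<subseteq> X1" "D2 \<subseteq> X2" by (auto simp: D1_def D2_def dom_on_def)
    have D_eq: "D = {u + w |u w. u \<in> D1 \<and> w \<in> D2}"
      using parts D_mem sub12 by blast
    have conj: "fenchel_conjugate f (u + w) = ereal (F1 u + F2 w)" if "u \<in> D1" "w \<in> D2" for u w
      using that fin_or_M[OF that] sep[of u w] sub12
      unfolding F1_def F2_def D1_def D2_def dom_on_def by (cases "f1c u"; cases "f2c w") auto
    have "closed D"
      unfolding D_eq
    proof (rule closed_orthogonal_sum[OF dec sub12])
      show "closed D2" unfolding D2_def using assms(12) by (rule affine_closed)
      have "closed X1" using dec by (simp add: orthogonal_decomposition_def closed_subspace)
      then show "closed D1"
        unfolding D1_def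
      proof (rule closed_dom_lipschitz_conjugate[OF _ lip])
        show "f1c = fenchel_conjugate_on X1 f1" by (simp add: f1c_def)
        show "\<And>\<mu>. \<mu> \<in> dom_on X1 f1c \<Longrightarrow> f1c \<mu> \<noteq> - \<infinity>"
          using fin_or_M(1) assms(13) unfolding D1_def D2_def by blast
      qed
    qed
    moreover have "convex D" unfolding D_def by (rule convex_dom_conjugate[OF proper])
    moreover have "D \<noteq> {}" using w by (auto simp: D_def dom_on_def)
    ultimately have proj: "dist (closest_point D u) (closest_point D w) \<le> dist u w"
        "closest_point D u \<in> D" "\<And>z. z \<in> D \<Longrightarrow> dist u (closest_point D u) \<le> dist u z" for u w
      by (auto intro: closest_point_lipschitz closest_point_in_set closest_point_le)

    \<comment> \<open>The subgradient inequality says that the supremum defining the conjugate at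
      \<open>q\<close> is attained at \<open>p\<close>.\<close>
    have "fenchel_conjugate f q \<le> ereal (q \<bullet> p - fp)"
      unfolding fenchel_conjugate_on_def
    proof (rule SUP_least)
      fix z show "ereal (q \<bullet> z) - f z \<le> ereal (q \<bullet> p - fp)"
        using sub(2)[of z] notM[of z] fp by (cases "f z") (auto simp: inner_diff_right)
    qed
    moreover have "ereal (q \<bullet> p - fp) \<le> fenchel_conjugate f q"
      using fenchel_young[of p UNIV q f] fp by simp
    ultimately have fq: "fenchel_conjugate f q = ereal (q \<bullet> p - fp)" by (rule antisym)
    then have qD: "q \<in> D" by (simp add: D_def dom_on_def)
    define a where "a = closest_point D (- adjoint A y)"
    have aD: "a \<in> D" unfolding a_def by (rule proj)
    have s_dist: "dist (- adjoint A y) q = norm s"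
      by (simp add: q_def dist_norm norm_minus_commute)
    have a_dist: "norm (a + adjoint A y) \<le> norm s"
    proof -
      have "norm (a + adjoint A y) = dist (- adjoint A y) a"
        by (subst dist_commute) (simp add: dist_norm)
      then show ?thesis using proj(3)[OF qD, of "- adjoint A y"] by (simp add: a_def s_dist)
    qed
    \<comment> \<open>\<open>q\<close> is its own projection, so nonexpansiveness applies to the
      pair \<open>- adjoint A y\<close> and \<open>q\<close>, which lie \<open>norm s\<close>
      apart.\<close>
    have aq: "norm (a - q) \<le> norm s"
      using proj(1)[of "- adjoint A y" q] closest_point_self[OF qD]
      by (simp add: a_def s_dist flip: dist_norm)
    obtain q1 q2 where q: "q1 \<in> D1" "q2 \<in> D2" "q = q1 + q2" using parts[OF qD] by blast
    obtain a1 a2 where a: "a1 \<in> D1" "a2 \<in> D2" "a = a1 + a2" using parts[OF aD] by blast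
    have "a1 - q1 \<in> X1" "a2 - q2 \<in> X2"
      using dec a q sub12 by (auto simp: orthogonal_decomposition_def intro!: subspace_diff)
    from norm_orthogonal_parts_le[OF dec this]
    have d12: "norm (a1 - q1) \<le> norm s" "norm (a2 - q2) \<le> norm s"
      using aq a(3) q(3) by (simp_all add: add_diff_add)

    define G where "G = fx - fp + (A (x - p) \<bullet> y - \<beta>x / 2 * (norm (p - x))\<^sup>2
        + 1 / (2 * \<beta>y) * (norm (A x - b))\<^sup>2)"
    define e where "e = fx + (F1 q1 + F2 q2) - x \<bullet> q"
    \<comment> \<open>\<open>h\<close> is the Fenchel-Young gap of \<open>x\<close> along the affine piece \<open>q1 + D2\<close> of the domain.\<close>
    define h where "h \<nu> = F2 \<nu> + (fx + F1 q1 - x \<bullet> q1) - x \<bullet> \<nu>" for \<nu>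
    define T where "T = fx + (F1 a1 + F2 a2) + b \<bullet> y"
    have h_nonneg: "0 \<le> h \<nu>" if "\<nu> \<in> D2" for \<nu>
      using fenchel_young[of x UNIV "q1 + \<nu>" f] fx conj[OF q(1) that]
      by (simp add: h_def inner_add_left inner_add_right inner_commute[of _ x])
    have e_h: "e = h q2" by (simp add: e_def h_def q(3) inner_add_right)
    have ns: "(norm s)\<^sup>2 = \<beta>x\<^sup>2 * (norm (p - x))\<^sup>2"
      using \<beta> by (simp add: s_def power_mult_distrib norm_minus_commute)
    have adj: "u \<bullet> adjoint A y = A u \<bullet> y" for u by (rule adjoint_works[OF A])
    \<comment> \<open>Fenchel equality gives \<open>fx - fp + A (x - p) \<bullet> y = e + \<beta>x *
      (norm (p - x))\<^sup>2\<close>. The negative proximal term of the gap takes away half of the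
      square, and the other half is \<open>(norm s)\<^sup>2 / (2 * \<beta>x)\<close>.\<close>
    have G: "G = e + (norm s)\<^sup>2 / (2 * \<beta>x) + (norm (A x - b))\<^sup>2 / (2 * \<beta>y)"
    proof -
      have "F1 q1 + F2 q2 = q \<bullet> p - fp" using fq conj[OF q(1,2)] q(3) by simp
      then have "e = fx - fp - q \<bullet> (x - p)"
        by (simp add: e_def inner_diff_right inner_commute[of x])
      also have "q \<bullet> (x - p) = \<beta>x * (norm (p - x))\<^sup>2 - A (x - p) \<bullet> y"
      proof -
        have "s \<bullet> (x - p) = \<beta>x * (norm (p - x))\<^sup>2"
          unfolding norm_minus_commute[of p x] by (simp add: s_def power2_norm_eq_inner)
        moreover have "adjoint A y \<bullet> (x - p) = A (x - p) \<bullet> y"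
          using adj[of "x - p"] by (subst inner_commute)
        ultimately show ?thesis by (simp only: q_def inner_diff_left[of s])
      qed
      finally have "e = fx - fp - (\<beta>x * (norm (p - x))\<^sup>2 - A (x - p) \<bullet> y)" .
      moreover have "(norm s)\<^sup>2 / (2 * \<beta>x) = \<beta>x / 2 * (norm (p - x))\<^sup>2"
        unfolding ns using \<beta> by (simp add: power2_eq_square)
      ultimately show ?thesis by (simp add: G_def)
    qed
    have "h a2 \<le> (2 + \<beta>x * Lg) * G"
    proof -
      define \<tau> where "\<tau> = 1 / (1 + \<beta>x * Lg)"
      have "\<tau> > 0" using \<beta> Lg by (simp add: \<tau>_def add_pos_nonneg)
      then have "h a2 \<le> (1 + 1 / \<tau>) * h q2 + (1 + \<tau>) * (Lg * (norm (a2 - q2))\<^sup>2) / 2"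
        unfolding h_def
        using affine_smooth_growth[OF smooth(1), of Lg F2 q2 a2 \<tau> "fx + F1 q1 - x \<bullet> q1" x]
          smooth(2) q(2) a(2) h_nonneg by (simp add: F2_def D2_def h_def)
      also have "\<dots> \<le> (2 + \<beta>x * Lg) * G"
        unfolding \<tau>_def
      proof (rule smoothness_weight_bound[OF \<beta>(1) Lg])
        show "0 \<le> h q2" by (rule h_nonneg[OF q(2)])
        show "h q2 + (norm s)\<^sup>2 / (2 * \<beta>x) \<le> G" using \<beta> by (simp add: G e_h)
        show "(norm (a2 - q2))\<^sup>2 \<le> (norm s)\<^sup>2" using d12(2) by (simp add: power_mono)
      qed
      finally show ?thesis .
    qed
    moreover have "\<bar>T - h a2\<bar> \<le> L1 * norm s + 2 * norm x * norm s + norm (A x - b) * norm y"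
    proof -
      \<comment> \<open>Replacing \<open>q1\<close> by \<open>s - adjoint A y - q2\<close> removes
        \<open>x \<bullet> q1\<close>. The terms \<open>x \<bullet> s\<close> and
        \<open>x \<bullet> (a2 - q2)\<close> each cost \<open>norm x * norm s\<close>, whence the
        factor 2.\<close>
      have "T - h a2 = (F1 a1 - F1 q1) + x \<bullet> s + x \<bullet> (a2 - q2) - (A x - b) \<bullet> y"
      proof -
        have "x \<bullet> q1 = x \<bullet> s - x \<bullet> q2 - A x \<bullet> y"
          using arg_cong[OF q(3), of "\<lambda>u. x \<bullet> u"] adj[of x]
          by (simp add: q_def inner_diff_right inner_add_right)
        then show ?thesis
          by (simp add: T_def h_def inner_diff_left inner_diff_right)
      qed
      moreover have "\<bar>F1 a1 - F1 q1\<bar> \<le> L1 * norm s"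
      proof -
        have "\<bar>F1 a1 - F1 q1\<bar> \<le> L1 * norm (a1 - q1)"
          using lipschitz_onD[OF lip, of a1 q1] a(1) q(1) by (simp add: F1_def D1_def dist_norm)
        also have "\<dots> \<le> L1 * norm s" using d12(1) L1 by (rule mult_left_mono)
        finally show ?thesis .
      qed
      moreover have "\<bar>x \<bullet> s\<bar> \<le> norm x * norm s" by (rule Cauchy_Schwarz_ineq2)
      moreover have "\<bar>x \<bullet> (a2 - q2)\<bar> \<le> norm x * norm s"
        using Cauchy_Schwarz_ineq2[of x "a2 - q2"] mult_left_mono[OF d12(2), of "norm x"] by simp
      moreover have "\<bar>(A x - b) \<bullet> y\<bar> \<le> norm (A x - b) * norm y" by (rule Cauchy_Schwarz_ineq2)
      ultimately show ?thesis by linarith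
    qed
    ultimately have main: "T\<^sup>2 + (norm (a + adjoint A y))\<^sup>2 + (norm (A x - b))\<^sup>2
      \<le> ((3 + \<beta>x * Lg) * G
          + (sqrt (2 * \<beta>x) * (2 * norm x + L1) + sqrt (2 * \<beta>y) * norm y) * sqrt G)\<^sup>2
        + 2 * max \<beta>x \<beta>y * G"
      using \<beta> Lg L1 G a_dist h_nonneg a(2) q(2)
      by (intro projected_gap_real_bound[where e = e and N = "norm s" and h = "h a2"])
        (auto simp: e_h)
    have "smoothed_gap f A b \<beta>x \<beta>y x y = ereal G" by (simp add: gap fx G_def)
    moreover have "projected_gap f A b x y
        = ereal (T\<^sup>2 + (norm (a + adjoint A y))\<^sup>2 + (norm (A x - b))\<^sup>2)"
      unfolding projected_gap_def Let_def D_def[symmetric] a_def[symmetric]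
      using conj[OF a(1,2)] by (simp add: fx a(3) T_def power2_eq_square)
    ultimately show ?thesis using main by (simp add: ereal_sqrt_def power2_eq_square)
  qed
qed

end
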